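(* Let $\Phi$ be a weighted undirected graph with finite vertex set ${\tt N}$ and edge weights $\phi_{ij}$, let $\aleph$ be a partition of ${\tt N}$ by which $\Phi$ is tree-divisible, let ${\textsc F}'\in{\sf F}^k(\Phi|\aleph)$ and let ${\textsc F}$ be a minimal principal of ${\textsc F}'$. Let $({\tt X},{\tt Y})$ be an edge of ${\textsc F}'$ and let $(x,y)$ be the unique edge of ${\textsc F}$ with $x\in{\tt X}$, $y\in{\tt Y}$. Then $$\mathrm f'_{\tt XY}=\phi^\aleph_{\tt XY}=\phi_{xy}=\mathrm f^\aleph_{\tt XY}.$$
   Context: Forests are acyclic undirected graphs, trees are connected acyclic graphs. For a subgraph ${\textsc G}$ of $\Phi$, $\Upsilon^{\textsc G}$ is the sum of the weights of its edges; ${\textsc G}|_{\tt D}$ is the induced subgraph on ${\tt D}$. ${\sf F}^k(G)$ is the set of spanning forests (subgraphs with vertex set ${\tt V}G$) of $G$ with exactly $k$ trees. For a spanning subgraph ${\textsc G}$ of $\Phi$ and ${\tt D}\subseteq{\tt N}$: ${\sf T}_{\tt D}({\textsc G})$ is the set of trees contained in ${\textsc G}$ with vertex set ${\tt D}$ and $\nu_{\tt D}({\textsc G})=\min_{{\textsc T}\in{\sf T}_{\tt D}({\textsc G})}\Upsilon^{\textsc T}$; for distinct ${\tt X},{\tt Y}\in\aleph$, ${\sf T}_{\tt XY}({\textsc G})$ is the set of trees ${\textsc T}\subseteq{\textsc G}$ with ${\textsc T}|_{\tt X}\in{\sf T}_{\tt X}({\textsc G})$, $|{\tt V}{\textsc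 T}|=|{\tt X}|+1$ and ${\tt V}{\textsc T}\cap{\tt Y}\ne\emptyset$, and $\nu_{\tt XY}({\textsc G})=\min_{{\textsc T}\in{\sf T}_{\tt XY}({\textsc G})}\Upsilon^{\textsc T}$; the argument is omitted when ${\textsc G}=\Phi$. ${\textsc G}$ is tree-divisible by $\aleph$ if ${\textsc G}|_{\tt X}$ is connected for every ${\tt X}\in\aleph$. The splitting ${\textsc G}|\aleph={\textsc G}^\aleph$ of a tree-divisible ${\textsc G}$ is the undirected graph with vertex set $\aleph$ having an edge $({\tt X},{\tt Y})$, ${\tt X}\ne{\tt Y}$, iff ${\sf T}_{\tt XY}({\textsc G})\ne\emptyset$, with weight $\nu_{\tt XY}({\textsc G})-\nu_{\tt X}({\textsc G})$. Write $\phi^\aleph_{\tt XY}=\nu_{\tt XY}-\nu_{\tt X}$ for the weights of $\Phi^\aleph$ and $\mathrm f^\aleph_{\tt XY}$ for the weights of ${\textsc F}^\aleph$. A tree-divisible ${\textsc F}\in{\sf F}^k(\Phi)$ is a principal of a spanning forest ${\textsc F}'$ of $\Phi|\aleph$ if the edge set of ${\textsc F}'$ equals that of ${\textsc F}^\aleph$; edges of ${\textsc F}'$ carry their weights in $\Phi^\aleph$, denoted $\mathrm f'_{\tt XY}$. A minimal principal of ${\textsc F}'$ is a principal of minimal weight $\Upsilon^{\textsc F}$ among all principals of ${\textsc F}'$. *)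

theory Defs
  imports Complex_Main "HOL-Library.Disjoint_Sets"
begin

text \<open>
  The edge with end points \<open>x\<close>, \<open>y\<close> is the set \<open>{x, y}\<close>, a loop being a singleton.
  Weights are indexed by ordered pairs of vertices, only the values on edges being
  relevant; they are required to be symmetric there.
\<close>

record 'a wgraph =
  verts :: "'a set"
  edges :: "'a set set"
  wt :: "'a \<Rightarrow> 'a \<Rightarrow> real"

definition undirected_graph :: "'a wgraph \<Rightarrow> bool" where
  "undirected_graph G \<longleftrightarrow>
     (\<forall>e\<in>edges G. \<exists>x\<in>verts G. \<exists>y\<in>verts G. e = {x, y}) \<and>
     (\<forall>x y. {x, y} \<in> edges G \<longrightarrow> wt G x y = wt G y x)"

text \<open>A subgraph inherits the weights of its edges.\<close>

definition subgraph :: "'a wgraph \<Rightarrow> 'a wgraph \<Rightarrow> bool" where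
  "subgraph H G \<longleftrightarrow>
     undirected_graph H \<and> verts H \<subseteq> verts G \<and> edges H \<subseteq> edges G \<and>
     (\<forall>x y. {x, y} \<in> edges H \<longrightarrow> wt H x y = wt G x y)"

definition induced :: "'a wgraph \<Rightarrow> 'a set \<Rightarrow> 'a wgraph" where
  "induced G D = \<lparr>verts = verts G \<inter> D, edges = {e \<in> edges G. e \<subseteq> D}, wt = wt G\<rparr>"

definition edge_weight :: "'a wgraph \<Rightarrow> 'a set \<Rightarrow> real" where
  "edge_weight G e = (THE r. \<forall>x y. e = {x, y} \<longrightarrow> r = wt G x y)"

definition total_weight :: "'a wgraph \<Rightarrow> real" where
  "total_weight G = (\<Sum>e\<in>edges G. edge_weight G e)"

definition reachable :: "'a wgraph \<Rightarrow> 'a \<Rightarrow> 'a \<Rightarrow> bool" where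
  "reachable G x y \<longleftrightarrow> x \<in> verts G \<and> y \<in> verts G \<and> (x, y) \<in> {(u, v). {u, v} \<in> edges G}\<^sup>*"

definition connected_graph :: "'a wgraph \<Rightarrow> bool" where
  "connected_graph G \<longleftrightarrow> verts G \<noteq> {} \<and> (\<forall>x\<in>verts G. \<forall>y\<in>verts G. reachable G x y)"

definition components :: "'a wgraph \<Rightarrow> 'a set set" where
  "components G = {{y. reachable G x y} | x. x \<in> verts G}"

text \<open>
  A cycle is listed by its distinct vertices in cyclic order. A list of length 2 would only
  traverse a single edge back and forth; a list of length 1 is a loop.
\<close>

definition cycle :: "'a wgraph \<Rightarrow> 'a list \<Rightarrow> bool" where
  "cycle G vs \<longleftrightarrow>
     distinct vs \<and> vs \<noteq> [] \<and> length vs \<noteq> 2 \<and>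
     (\<forall>i<length vs. {vs ! i, vs ! (Suc i mod length vs)} \<in> edges G)"

definition forest :: "'a wgraph \<Rightarrow> bool" where
  "forest G \<longleftrightarrow> undirected_graph G \<and> (\<nexists>vs. cycle G vs)"

definition tree :: "'a wgraph \<Rightarrow> bool" where
  "tree G \<longleftrightarrow> forest G \<and> connected_graph G"

definition spanning_forests :: "nat \<Rightarrow> 'a wgraph \<Rightarrow> 'a wgraph set" where
  "spanning_forests k G =
     {F. subgraph F G \<and> verts F = verts G \<and> forest F \<and> card (components F) = k}"

definition trees_on :: "'a wgraph \<Rightarrow> 'a set \<Rightarrow> 'a wgraph set" where
  "trees_on G D = {T. subgraph T G \<and> tree T \<and> verts T = D}"

definition nu :: "'a wgraph \<Rightarrow> 'a set \<Rightarrow> real" where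
  "nu G D = Min (total_weight ` trees_on G D)"

definition trees_between :: "'a wgraph \<Rightarrow> 'a set \<Rightarrow> 'a set \<Rightarrow> 'a wgraph set" where
  "trees_between G X Y =
     {T. subgraph T G \<and> tree T \<and> induced T X \<in> trees_on G X \<and>
         card (verts T) = card X + 1 \<and> verts T \<inter> Y \<noteq> {}}"

definition nu_between :: "'a wgraph \<Rightarrow> 'a set \<Rightarrow> 'a set \<Rightarrow> real" where
  "nu_between G X Y = Min (total_weight ` trees_between G X Y)"

definition tree_divisible :: "'a wgraph \<Rightarrow> 'a set set \<Rightarrow> bool" where
  "tree_divisible G P \<longleftrightarrow> (\<forall>X\<in>P. connected_graph (induced G X))"

definition splitting :: "'a wgraph \<Rightarrow> 'a set set \<Rightarrow> 'a set wgraph" where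
  "splitting G P =
     \<lparr>verts = P,
      edges = {{X, Y} | X Y. X \<in> P \<and> Y \<in> P \<and> X \<noteq> Y \<and> trees_between G X Y \<noteq> {}},
      wt = (\<lambda>X Y. nu_between G X Y - nu G X)\<rparr>"

definition principal :: "'a wgraph \<Rightarrow> 'a set set \<Rightarrow> 'a set wgraph \<Rightarrow> 'a wgraph \<Rightarrow> bool" where
  "principal \<Phi> P F' F \<longleftrightarrow>
     (\<exists>k. F \<in> spanning_forests k \<Phi>) \<and> tree_divisible F P \<and> edges F' = edges (splitting F P)"

definition minimal_principal ::
    "'a wgraph \<Rightarrow> 'a set set \<Rightarrow> 'a set wgraph \<Rightarrow> 'a wgraph \<Rightarrow> bool" where
  "minimal_principal \<Phi> P F' F \<longleftrightarrow>
     principal \<Phi> P F' F \<and>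
     (\<forall>H. principal \<Phi> P F' H \<longrightarrow> total_weight F \<le> total_weight H)"

end

theory Submission
  imports Defs
begin

text \<open>
  A tree of \<^term>\<open>trees_between G X Y\<close> is a tree on \<open>X\<close> together with one pendant edge leading
  to \<open>Y\<close>, and both parts can be chosen independently. Hence the weight of \<open>{X, Y}\<close> in the
  splitting of \<open>G\<close> is the least weight of an edge of \<open>G\<close> between \<open>X\<close> and \<open>Y\<close>. In a principal \<open>F\<close>
  there is only one such edge, since two of them would close a cycle through the connected graphs
  induced on \<open>X\<close> and \<open>Y\<close>. Exchanging it for any other edge of \<open>\<Phi>\<close> between \<open>X\<close> and \<open>Y\<close> gives again a
  principal, so in a minimal principal it has the least weight.
\<close>

section \<open>Acyclicity of edge sets\<close>

definition adj :: "'a set set \<Rightarrow> 'a rel" where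
  "adj E = {(u, v). {u, v} \<in> E}"

text \<open>Every edge is a bridge; a loop violates this because reachability is reflexive.\<close>

definition acyclic_edges :: "'a set set \<Rightarrow> bool" where
  "acyclic_edges E \<longleftrightarrow> (\<forall>u v. {u, v} \<in> E \<longrightarrow> (u, v) \<notin> (adj (E - {{u, v}}))\<^sup>*)"

lemma adj_iff [simp]: "(u, v) \<in> adj E \<longleftrightarrow> {u, v} \<in> E"
  by (simp add: adj_def)

lemma adj_rtrancl_mono: "E \<subseteq> E' \<Longrightarrow> (u, v) \<in> (adj E)\<^sup>* \<Longrightarrow> (u, v) \<in> (adj E')\<^sup>*"
  by (rule set_mp[OF rtrancl_mono]) (auto simp: adj_def)

lemma adj_rtranclI: "{u, v} \<in> E \<Longrightarrow> (u, v) \<in> (adj E)\<^sup>*"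
  by (simp add: r_into_rtrancl)

lemma adj_rtrancl_sym: "(u, v) \<in> (adj E)\<^sup>* \<Longrightarrow> (v, u) \<in> (adj E)\<^sup>*"
  by (rule symD[OF sym_rtrancl]) (auto simp: sym_def insert_commute)

lemma acyclic_edges_mono: "acyclic_edges E \<Longrightarrow> D \<subseteq> E \<Longrightarrow> acyclic_edges D"
  unfolding acyclic_edges_def
  by (meson Diff_mono adj_rtrancl_mono equalityE subsetD)

text \<open>A walk that traverses the new edge several times can be shortened to one that uses it at
  most once, in one of the two directions.\<close>

lemma adj_rtrancl_insert:
  assumes "(u, v) \<in> (adj (insert {a, b} E))\<^sup>*"
  shows "(u, v) \<in> (adj E)\<^sup>* \<or>
    (u, a) \<in> (adj E)\<^sup>* \<and> (b, v) \<in> (adj E)\<^sup>* \<or> (u, b) \<in> (adj E)\<^sup>* \<and> (a, v) \<in> (adj E)\<^sup>*"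
  using assms
proof (induction rule: rtrancl_induct)
  case base
  then show ?case by simp
next
  case (step v w)
  show ?case
  proof (cases "{v, w} \<in> E")
    case True
    then have "(v, w) \<in> adj E" by simp
    with step.IH show ?thesis by (meson rtrancl.rtrancl_into_rtrancl)
  next
    case False
    with step.hyps have "v = a \<and> w = b \<or> v = b \<and> w = a"
      by (auto simp: doubleton_eq_iff)
    with step.IH show ?thesis by (meson adj_rtrancl_sym rtrancl.rtrancl_refl rtrancl_trans)
  qed
qed

text \<open>Joining two different components closes no cycle: a detour around an old edge
  \<open>{u, v}\<close> through the new edge would, together with \<open>{u, v}\<close>, already
  connect \<open>a\<close> and \<open>b\<close> in \<open>E\<close>.\<close>

lemma acyclic_edges_insert:
  assumes ac: "acyclic_edges E" and ab: "(a, b) \<notin> (adj E)\<^sup>*"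
  shows "acyclic_edges (insert {a, b} E)"
  unfolding acyclic_edges_def
proof (intro allI impI notI)
  fix u v
  assume uv: "{u, v} \<in> insert {a, b} E"
    and path: "(u, v) \<in> (adj (insert {a, b} E - {{u, v}}))\<^sup>*"
  show False
  proof (cases "{u, v} = {a, b}")
    case True
    then have "(u, v) \<in> (adj E)\<^sup>*" using path by (auto intro: adj_rtrancl_mono[rotated])
    with True ab show False by (metis adj_rtrancl_sym doubleton_eq_iff)
  next
    case False
    with uv have uvE: "{u, v} \<in> E" by auto
    define D where "D = E - {{u, v}}"
    from False have "insert {a, b} E - {{u, v}} = insert {a, b} D" by (auto simp: D_def)
    with path have "(u, v) \<in> (adj (insert {a, b} D))\<^sup>*" by simp
    then have "(u, v) \<in> (adj D)\<^sup>* \<or>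
      (u, a) \<in> (adj D)\<^sup>* \<and> (b, v) \<in> (adj D)\<^sup>* \<or> (u, b) \<in> (adj D)\<^sup>* \<and> (a, v) \<in> (adj D)\<^sup>*"
      by (rule adj_rtrancl_insert)
    moreover have "(u, v) \<notin> (adj D)\<^sup>*" using ac uvE by (auto simp: acyclic_edges_def D_def)
    moreover have "(s, t) \<in> (adj E)\<^sup>*" if "(s, t) \<in> (adj D)\<^sup>*" for s t
      using that by (auto simp: D_def intro: adj_rtrancl_mono[rotated])
    moreover have "(u, v) \<in> (adj E)\<^sup>*" using uvE by auto
    ultimately show False using ab by (meson adj_rtrancl_sym rtrancl_trans)
  qed
qed

section \<open>Simple paths and cycles\<close>

lemma adj_rtrancl_simple_path:
  assumes "(u, v) \<in> (adj E)\<^sup>*"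
  shows "\<exists>vs. vs \<noteq> [] \<and> distinct vs \<and> vs ! 0 = u \<and> vs ! (length vs - 1) = v \<and>
    (\<forall>i. Suc i < length vs \<longrightarrow> {vs ! i, vs ! Suc i} \<in> E)"
  using assms
proof (induction rule: rtrancl_induct)
  case base
  show ?case by (rule exI[of _ "[u]"]) simp
next
  case (step v w)
  then obtain vs where vs: "vs \<noteq> []" "distinct vs" "vs ! 0 = u" "vs ! (length vs - 1) = v"
    "\<And>i. Suc i < length vs \<Longrightarrow> {vs ! i, vs ! Suc i} \<in> E" by auto
  show ?case
  proof (cases "w \<in> set vs")
    case True
    then obtain j where "j < length vs" "vs ! j = w" by (auto simp: in_set_conv_nth)
    \<comment> \<open>Cutting the list at the earlier occurrence of \<open>w\<close> drops the
      closed detour back to it.\<close>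
    with vs show ?thesis by (intro exI[of _ "take (Suc j) vs"]) auto
  next
    case False
    have "{(vs @ [w]) ! i, (vs @ [w]) ! Suc i} \<in> E" if "Suc i < length (vs @ [w])" for i
    proof (cases "Suc i < length vs")
      case True
      with vs(5) show ?thesis by (simp add: nth_append)
    next
      case False
      with that have "i = length vs - 1" "Suc i = length vs" by auto
      with vs(1,4) step.hyps show ?thesis by (simp add: nth_append)
    qed
    with False vs show ?thesis by (intro exI[of _ "vs @ [w]"]) (auto simp: nth_append)
  qed
qed

text \<open>Any edge of a cycle is bypassed by the rest of the cycle, and a simple path bypassing an
  edge is closed to a cycle by that edge. This replaces lists by reachability in all later
  arguments.\<close>

lemma forest_iff_acyclic_edges: "forest G \<longleftrightarrow> undirected_graph G \<and> acyclic_edges (edges G)"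
proof -
  have "\<not> acyclic_edges (edges G)" if "cycle G vs" for vs
  proof -
    let ?n = "length vs"
    from that have d: "distinct vs" and n: "?n \<noteq> 0" "?n \<noteq> 2"
      and e: "\<And>i. i < ?n \<Longrightarrow> {vs ! i, vs ! (Suc i mod ?n)} \<in> edges G"
      by (auto simp: cycle_def)
    let ?D = "edges G - {{vs ! 0, vs ! (?n - 1)}}"
    have "(vs ! 0, vs ! i) \<in> (adj ?D)\<^sup>*" if "i < ?n" for i
      using that
    proof (induction i)
      case 0
      then show ?case by simp
    next
      case (Suc i)
      \<comment> \<open>Consecutive positions coincide with the first and the last one only in a
        list of length 2.\<close>
      have "{vs ! i, vs ! Suc i} \<noteq> {vs ! 0, vs ! (?n - 1)}"
        using Suc.prems d n by (auto simp: doubleton_eq_iff nth_eq_iff_index_eq)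
      with e[of i] Suc.prems have "(vs ! i, vs ! Suc i) \<in> adj ?D" by simp
      with Suc show ?case by (meson Suc_lessD rtrancl.rtrancl_into_rtrancl)
    qed
    then have "(vs ! 0, vs ! (?n - 1)) \<in> (adj ?D)\<^sup>*" using n by simp
    moreover have "{vs ! 0, vs ! (?n - 1)} \<in> edges G"
      using e[of "?n - 1"] n by (simp add: insert_commute)
    ultimately show ?thesis by (auto simp: acyclic_edges_def)
  qed
  moreover have "\<exists>vs. cycle G vs" if nac: "\<not> acyclic_edges (edges G)"
  proof -
    from nac obtain u v where uv: "{u, v} \<in> edges G"
      and path: "(u, v) \<in> (adj (edges G - {{u, v}}))\<^sup>*"
      by (auto simp: acyclic_edges_def)
    from adj_rtrancl_simple_path[OF path] obtain vs where vs: "vs \<noteq> []" "distinct vs"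
      "vs ! 0 = u" "vs ! (length vs - 1) = v"
      "\<And>i. Suc i < length vs \<Longrightarrow> {vs ! i, vs ! Suc i} \<in> edges G - {{u, v}}" by auto
    \<comment> \<open>A path on two vertices would be the edge \<open>{u, v}\<close> itself, which
      was removed; a loop yields a list of length 1.\<close>
    have "length vs \<noteq> 2" using vs(3,4) vs(5)[of 0] by auto
    moreover have "{vs ! i, vs ! (Suc i mod length vs)} \<in> edges G" if "i < length vs" for i
    proof (cases "Suc i < length vs")
      case True
      with vs(5)[OF True] show ?thesis by simp
    next
      case False
      with that have "Suc i = length vs" "i = length vs - 1" by auto
      then show ?thesis using vs(3,4) uv by (simp add: insert_commute)
    qed
    ultimately show ?thesis using vs(1,2) by (auto simp: cycle_def)
  qed
  ultimately show ?thesis by (auto simp: forest_def)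
qed

lemma tree_iff:
  "tree G \<longleftrightarrow> undirected_graph G \<and> acyclic_edges (edges G) \<and> verts G \<noteq> {} \<and>
     (\<forall>x\<in>verts G. \<forall>y\<in>verts G. (x, y) \<in> (adj (edges G))\<^sup>*)"
  by (auto simp: tree_def forest_iff_acyclic_edges connected_graph_def reachable_def adj_def)

section \<open>Weights of subgraphs\<close>

text \<open>Symmetry of the weights on edges makes the definite description independent of the order
  of the end points.\<close>

lemma edge_weight_doubleton:
  assumes "undirected_graph G" "{x, y} \<in> edges G"
  shows "edge_weight G {x, y} = wt G x y"
  unfolding edge_weight_def
proof (rule the_equality)
  show "\<forall>x' y'. {x, y} = {x', y'} \<longrightarrow> wt G x y = wt G x' y'"
    using assms by (auto simp: doubleton_eq_iff undirected_graph_def)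
qed blast

lemma undirected_edgeE:
  assumes "undirected_graph G" "e \<in> edges G"
  obtains x y where "e = {x, y}" "x \<in> verts G" "y \<in> verts G"
  using assms by (auto simp: undirected_graph_def)

lemma undirected_edge_verts:
  assumes "undirected_graph G" "{x, y} \<in> edges G"
  shows "x \<in> verts G" "y \<in> verts G"
  using undirected_edgeE[OF assms] by (auto simp: doubleton_eq_iff)

lemma undirected_wt_sym: "undirected_graph G \<Longrightarrow> {x, y} \<in> edges G \<Longrightarrow> wt G x y = wt G y x"
  unfolding undirected_graph_def by blast

lemma subgraph_undirected: "subgraph H G \<Longrightarrow> undirected_graph H"
  by (simp add: subgraph_def)

lemma undirected_finite_edges:
  assumes "undirected_graph G" "finite (verts G)"
  shows "finite (edges G)"
proof (rule finite_subset)
  show "edges G \<subseteq> Pow (verts G)" by (auto elim: undirected_edgeE[OF assms(1)])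
qed (use assms in simp)

text \<open>Weights of different subgraphs become sums of one and the same function and can be
  compared edge by edge.\<close>

lemma subgraph_total_weight:
  assumes "undirected_graph G" "subgraph H G"
  shows "total_weight H = sum (edge_weight G) (edges H)"
  unfolding total_weight_def
proof (rule sum.cong)
  fix e assume e: "e \<in> edges H"
  with undirected_edgeE[OF subgraph_undirected[OF assms(2)]] obtain x y where "e = {x, y}"
    by metis
  with e assms show "edge_weight H e = edge_weight G e"
    by (simp add: edge_weight_doubleton subgraph_def subset_iff)
qed simp

text \<open>There may be infinitely many subgraphs, as \<open>wt\<close> is arbitrary off the edges,
  but their weights depend only on the edge set. This makes the minima in \<open>nu\<close> and
  \<open>nu_between\<close> meaningful.\<close>

lemma finite_total_weights:
  assumes "undirected_graph G" "finite (verts G)" "\<And>T. T \<in> S \<Longrightarrow> subgraph T G"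
  shows "finite (total_weight ` S)"
proof (rule finite_subset)
  show "total_weight ` S \<subseteq> sum (edge_weight G) ` Pow (edges G)"
    using assms by (auto simp: subgraph_total_weight subgraph_def)
  show "finite (sum (edge_weight G) ` Pow (edges G))"
    using undirected_finite_edges[OF assms(1,2)] by simp
qed

lemma subgraph_trans: "subgraph T H \<Longrightarrow> subgraph H G \<Longrightarrow> subgraph T G"
  by (auto simp: subgraph_def subset_iff)

lemma subgraph_induced:
  assumes "undirected_graph G"
  shows "subgraph (induced G X) G"
proof -
  have "\<exists>x\<in>verts G \<inter> X. \<exists>y\<in>verts G \<inter> X. e = {x, y}" if "e \<in> edges G" "e \<subseteq> X" for e
  proof -
    obtain x y where "e = {x, y}" "x \<in> verts G" "y \<in> verts G"
      using undirected_edgeE[OF assms \<open>e \<in> edges G\<close>] by metis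
    with \<open>e \<subseteq> X\<close> show ?thesis by auto
  qed
  then have "undirected_graph (induced G X)"
    using undirected_wt_sym[OF assms] unfolding undirected_graph_def induced_def by auto
  then show ?thesis by (auto simp: subgraph_def induced_def)
qed

section \<open>Trees between two parts\<close>

text \<open>The vertex count leaves a single vertex \<open>y\<close> outside \<open>X\<close>, and
  \<open>y\<close> has a single neighbour, since two edges from \<open>y\<close> into the connected
  part on \<open>X\<close> would close a cycle.\<close>

lemma trees_between_decomp:
  assumes G: "undirected_graph G" "finite (verts G)" and XY: "X \<inter> Y = {}"
    and T: "T \<in> trees_between G X Y"
  obtains x y where "x \<in> X" "y \<in> Y" "{x, y} \<in> edges G" "induced T X \<in> trees_on G X"
    "total_weight T = total_weight (induced T X) + wt G x y"
proof -
  from T have sub: "subgraph T G" and tr: "tree T" and ind: "induced T X \<in> trees_on G X"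
    and card: "card (verts T) = card X + 1" and "verts T \<inter> Y \<noteq> {}"
    by (auto simp: trees_between_def)
  then obtain y where y: "y \<in> verts T" "y \<in> Y" by blast
  from sub G(2) have fin: "finite (verts T)" by (auto simp: subgraph_def intro: finite_subset)
  from ind have "verts (induced T X) = X" by (simp add: trees_on_def)
  then have XT: "X \<subseteq> verts T" by (auto simp: induced_def)
  have yX: "y \<notin> X" using y XY by auto
  have VT: "verts T = insert y X"
    using card_subset_eq[OF fin, of "insert y X"] XT y(1) yX card finite_subset[OF XT fin] by auto
  from tr have und: "undirected_graph T" and ac: "acyclic_edges (edges T)"
    and conn: "\<And>u v. u \<in> verts T \<Longrightarrow> v \<in> verts T \<Longrightarrow> (u, v) \<in> (adj (edges T))\<^sup>*"
    by (auto simp: tree_iff)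
  let ?EX = "{e \<in> edges T. e \<subseteq> X}"
  from ind have indc: "X \<noteq> {}" "\<And>u v. u \<in> X \<Longrightarrow> v \<in> X \<Longrightarrow> (u, v) \<in> (adj ?EX)\<^sup>*"
    using \<open>verts (induced T X) = X\<close> by (auto simp: trees_on_def tree_iff induced_def)
  have noloop: "{y} \<notin> edges T" using ac unfolding acyclic_edges_def
    by (metis insert_absorb2 rtrancl.rtrancl_refl)
  have nbr: "z \<in> X" if "{y, z} \<in> edges T" for z
    using undirected_edge_verts[OF und that] noloop that VT by auto
  from indc(1) obtain x0 where "x0 \<in> X" by blast
  \<comment> \<open>The first step of a path from \<open>y\<close> into \<open>X\<close> supplies
    the pendant edge.\<close>
  with conn y(1) XT have "(y, x0) \<in> (adj (edges T))\<^sup>*" by blast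
  with \<open>x0 \<in> X\<close> yX obtain x where "{y, x} \<in> edges T"
    by (metis adj_iff converse_rtranclE)
  with nbr have x: "x \<in> X" "{x, y} \<in> edges T" by (auto simp: insert_commute)
  have uniq: "z = x" if "{z, y} \<in> edges T" for z
  proof (rule ccontr)
    assume "z \<noteq> x"
    have "z \<in> X" using nbr that by (simp add: insert_commute)
    have "(x, z) \<in> (adj (edges T - {{x, y}}))\<^sup>*"
      \<comment> \<open>The path stays inside \<open>X\<close>, hence avoids the edge to
        \<open>y\<close>.\<close>
      using indc(2)[OF x(1) \<open>z \<in> X\<close>] by (rule adj_rtrancl_mono[rotated]) (use yX in auto)
    moreover have "(z, y) \<in> adj (edges T - {{x, y}})"
      using that \<open>z \<noteq> x\<close> by (auto simp: doubleton_eq_iff)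
    ultimately have "(x, y) \<in> (adj (edges T - {{x, y}}))\<^sup>*"
      by (rule rtrancl.rtrancl_into_rtrancl)
    with ac x(2) show False unfolding acyclic_edges_def by blast
  qed
  have "e = {x, y}" if e: "e \<in> edges T" "\<not> e \<subseteq> X" for e
  proof -
    obtain a b where ab: "e = {a, b}" "a \<in> verts T" "b \<in> verts T"
      using undirected_edgeE[OF und e(1)] by metis
    with e VT have "a = y \<or> b = y" by auto
    with ab(1) uniq[of a] uniq[of b] e(1) show ?thesis by (auto simp: insert_commute)
  qed
  with x have eT: "edges T = insert {x, y} ?EX" by blast
  have "finite ?EX" using undirected_finite_edges[OF und fin] by simp
  moreover have "{x, y} \<notin> ?EX" using yX by auto
  ultimately have "sum (edge_weight G) (edges T) = edge_weight G {x, y} + sum (edge_weight G) ?EX"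
    by (subst eT) simp
  moreover have xyG: "{x, y} \<in> edges G" using x(2) sub by (auto simp: subgraph_def)
  moreover have "subgraph (induced T X) G" using ind by (simp add: trees_on_def)
  ultimately have "total_weight T = total_weight (induced T X) + wt G x y"
    using subgraph_total_weight[OF G(1) sub] subgraph_total_weight[OF G(1), of "induced T X"]
      edge_weight_doubleton[OF G(1) xyG] by (simp add: induced_def)
  with that x(1) y(2) xyG ind show thesis by blast
qed

text \<open>The new vertex is not a vertex of \<open>T\<close>, so attaching it by one edge keeps
  the graph acyclic and connected.\<close>

lemma trees_between_extend:
  assumes G: "undirected_graph G" "finite (verts G)" and XY: "X \<inter> Y = {}"
    and T: "T \<in> trees_on G X" and xy: "x \<in> X" "y \<in> Y" "{x, y} \<in> edges G"
  obtains T' where "T' \<in> trees_between G X Y" "total_weight T' = total_weight T + wt G x y"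
proof -
  from T have sub: "subgraph T G" and tr: "tree T" and VT: "verts T = X"
    by (auto simp: trees_on_def)
  from tr have und: "undirected_graph T" and ac: "acyclic_edges (edges T)"
    and conn: "\<And>u v. u \<in> X \<Longrightarrow> v \<in> X \<Longrightarrow> (u, v) \<in> (adj (edges T))\<^sup>*"
    by (auto simp: tree_iff VT)
  have yX: "y \<notin> X" using xy XY by auto
  have eX: "e \<subseteq> X" if "e \<in> edges T" for e using undirected_edgeE[OF und that] VT by auto
  have finX: "finite X" using sub G(2) VT by (auto simp: subgraph_def intro: finite_subset)
  \<comment> \<open>The weights come from \<open>G\<close>, because those of \<open>T\<close> are
    prescribed only on the edges of \<open>T\<close>.\<close>
  define T' where "T' = \<lparr>verts = insert y X, edges = insert {x, y} (edges T), wt = wt G\<rparr>"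
  have ET': "edges T' \<subseteq> edges G" using sub xy(3) by (auto simp: T'_def subgraph_def)
  have "\<exists>a\<in>verts T'. \<exists>b\<in>verts T'. e = {a, b}" if e: "e \<in> edges T'" for e
  proof (cases "e = {x, y}")
    case True
    with xy(1) show ?thesis by (auto simp: T'_def)
  next
    case False
    with e have "e \<in> edges T" by (simp add: T'_def)
    then obtain a b where "e = {a, b}" "a \<in> X" "b \<in> X" using undirected_edgeE[OF und] VT by metis
    then show ?thesis by (auto simp: T'_def)
  qed
  moreover have "wt T' a b = wt T' b a" if "{a, b} \<in> edges T'" for a b
  proof -
    have "{a, b} \<in> edges G" using that ET' by blast
    from undirected_wt_sym[OF G(1) this] show ?thesis by (simp add: T'_def)
  qed
  ultimately have und': "undirected_graph T'" unfolding undirected_graph_def by blast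
  have sub': "subgraph T' G"
    using und' sub xy VT undirected_edge_verts[OF G(1) xy(3)] by (auto simp: subgraph_def T'_def)
  \<comment> \<open>The last edge of such a path would lie in \<open>T\<close> and contain
    \<open>y\<close>, but the edges of \<open>T\<close> lie inside \<open>X\<close>.\<close>
  have "(x, y) \<notin> (adj (edges T))\<^sup>*"
  proof
    assume "(x, y) \<in> (adj (edges T))\<^sup>*"
    then show False using xy(1) yX
      by (cases rule: rtranclE) (auto dest: eX)
  qed
  then have ac': "acyclic_edges (edges T')"
    using acyclic_edges_insert[OF ac] by (simp add: T'_def)
  have to_x: "(x, v) \<in> (adj (edges T'))\<^sup>*" if "v \<in> insert y X" for v
  proof (cases "v = y")
    case True
    then show ?thesis by (auto simp: T'_def)
  next
    case False
    with that conn[OF xy(1)] show ?thesis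
      by (auto simp: T'_def intro: adj_rtrancl_mono[rotated])
  qed
  have "(u, v) \<in> (adj (edges T'))\<^sup>*" if "u \<in> insert y X" "v \<in> insert y X" for u v
    using to_x[OF that(1)] to_x[OF that(2)] by (meson adj_rtrancl_sym rtrancl_trans)
  then have tr': "tree T'" using und' ac' unfolding tree_iff by (simp add: T'_def)
  have indv: "verts (induced T' X) = X" and inde: "edges (induced T' X) = edges T"
    using yX eX by (auto simp: induced_def T'_def)
  have indsub: "subgraph (induced T' X) G"
    using subgraph_trans[OF subgraph_induced[OF und'] sub'] .
  \<comment> \<open>This graph agrees with \<open>T\<close> in vertices and edges, though possibly
    not in \<open>wt\<close> off the edges.\<close>
  have "tree (induced T' X)"
    using indsub tr VT unfolding tree_iff indv inde by (simp add: subgraph_undirected)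
  then have "T' \<in> trees_between G X Y"
    using sub' tr' indsub indv xy yX finX by (auto simp: trees_between_def trees_on_def T'_def)
  moreover have "total_weight T' = total_weight T + wt G x y"
  proof -
    have "{x, y} \<notin> edges T" using eX yX by blast
    moreover have "finite (edges T)" using undirected_finite_edges[OF und] VT finX by simp
    ultimately show ?thesis
      using subgraph_total_weight[OF G(1) sub] subgraph_total_weight[OF G(1) sub']
        edge_weight_doubleton[OF G(1) xy(3)] by (simp add: T'_def)
  qed
  ultimately show thesis using that by blast
qed

text \<open>A tree between the parts contains a crossing edge, and a crossing edge can be attached
  to any tree on \<open>X\<close>.\<close>

lemma trees_between_nonempty_iff:
  assumes "undirected_graph G" "finite (verts G)" "X \<inter> Y = {}" "trees_on G X \<noteq> {}"
  shows "trees_between G X Y \<noteq> {} \<longleftrightarrow> (\<exists>x\<in>X. \<exists>y\<in>Y. {x, y} \<in> edges G)"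
proof
  assume "trees_between G X Y \<noteq> {}"
  then show "\<exists>x\<in>X. \<exists>y\<in>Y. {x, y} \<in> edges G"
    using trees_between_decomp[OF assms(1-3)] by (metis ex_in_conv)
next
  assume "\<exists>x\<in>X. \<exists>y\<in>Y. {x, y} \<in> edges G"
  then show "trees_between G X Y \<noteq> {}"
    using trees_between_extend[OF assms(1-3)] assms(4) by (metis ex_in_conv)
qed

text \<open>The minimum of a sum of two independent choices, a tree on \<open>X\<close> and a
  crossing edge, is the sum of the two minima.\<close>

lemma nu_between_minus_nu:
  assumes G: "undirected_graph G" "finite (verts G)" and XY: "X \<inter> Y = {}"
    and ne: "trees_on G X \<noteq> {}" and xy: "x \<in> X" "y \<in> Y" "{x, y} \<in> edges G"
    and min: "\<And>x' y'. x' \<in> X \<Longrightarrow> y' \<in> Y \<Longrightarrow> {x', y'} \<in> edges G \<Longrightarrow> wt G x y \<le> wt G x' y'"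
  shows "nu_between G X Y - nu G X = wt G x y"
proof -
  have fin: "finite (total_weight ` trees_on G X)" "finite (total_weight ` trees_between G X Y)"
    by (rule finite_total_weights[OF G]; simp add: trees_on_def trees_between_def)+
  have "nu G X \<in> total_weight ` trees_on G X"
    unfolding nu_def using fin(1) ne by (intro Min_in) auto
  then obtain T where T: "T \<in> trees_on G X" "total_weight T = nu G X" by auto
  have "nu_between G X Y = nu G X + wt G x y"
    unfolding nu_between_def
  proof (rule Min_eqI[OF fin(2)])
    fix w assume "w \<in> total_weight ` trees_between G X Y"
    then obtain S where S: "S \<in> trees_between G X Y" "w = total_weight S" by auto
    from trees_between_decomp[OF G XY S(1)] obtain x' y' where
      d: "x' \<in> X" "y' \<in> Y" "{x', y'} \<in> edges G" "induced S X \<in> trees_on G X"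
      "total_weight S = total_weight (induced S X) + wt G x' y'" by metis
    \<comment> \<open>The two summands of \<open>total_weight S\<close> are bounded
      separately.\<close>
    have "nu G X \<le> total_weight (induced S X)"
      unfolding nu_def using fin(1) d(4) by (intro Min_le) auto
    with min[OF d(1-3)] d(5) S(2) show "nu G X + wt G x y \<le> w" by simp
  next
    \<comment> \<open>The bound is attained by attaching \<open>{x, y}\<close> to a lightest tree on
      \<open>X\<close>.\<close>
    from trees_between_extend[OF G XY T(1) xy]
    show "nu G X + wt G x y \<in> total_weight ` trees_between G X Y" using T(2) by (metis imageI)
  qed
  then show ?thesis by simp
qed

section \<open>Exchanging an edge of a principal\<close>

text \<open>Tree-divisibility asks only for connectedness; acyclicity passes from the forest to its
  induced subgraphs.\<close>

lemma induced_forest_in_trees_on: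
  assumes "forest F" "connected_graph (induced F X)" "X \<subseteq> verts F"
  shows "induced F X \<in> trees_on F X"
proof -
  have und: "undirected_graph F" and ac: "acyclic_edges (edges F)"
    using assms(1) by (auto simp: forest_iff_acyclic_edges)
  have sub: "subgraph (induced F X) F" using subgraph_induced[OF und] .
  have "acyclic_edges (edges (induced F X))"
    using ac by (rule acyclic_edges_mono) (auto simp: induced_def)
  with sub have "forest (induced F X)" by (simp add: forest_iff_acyclic_edges subgraph_undirected)
  with sub assms show ?thesis by (auto simp: trees_on_def tree_def induced_def)
qed

text \<open>Adjacency in the splitting reduces to crossing edges, a criterion that is symmetric in
  the two parts and easy to compare between two forests.\<close>

lemma edges_splitting:
  assumes F: "forest F" "finite (verts F)" and P: "partition_on (verts F) P" "tree_divisible F P"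
  shows "edges (splitting F P) =
    {{A, B} |A B. A \<in> P \<and> B \<in> P \<and> A \<noteq> B \<and> (\<exists>a\<in>A. \<exists>b\<in>B. {a, b} \<in> edges F)}"
proof -
  have "trees_between F A B \<noteq> {} \<longleftrightarrow> (\<exists>a\<in>A. \<exists>b\<in>B. {a, b} \<in> edges F)"
    if "A \<in> P" "B \<in> P" "A \<noteq> B" for A B
  proof (rule trees_between_nonempty_iff)
    show "undirected_graph F" using F(1) by (simp add: forest_def)
    show "A \<inter> B = {}" using P(1) that by (auto simp: partition_on_def disjoint_def)
    have "A \<subseteq> verts F" using P(1) that by (auto simp: partition_on_def)
    then show "trees_on F A \<noteq> {}"
      using induced_forest_in_trees_on[OF F(1)] P(2) that(1) by (auto simp: tree_divisible_def)
  qed fact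
  then have *: "A \<in> P \<and> B \<in> P \<and> A \<noteq> B \<and> trees_between F A B \<noteq> {} \<longleftrightarrow>
    A \<in> P \<and> B \<in> P \<and> A \<noteq> B \<and> (\<exists>a\<in>A. \<exists>b\<in>B. {a, b} \<in> edges F)" for A B
    by blast
  show ?thesis unfolding splitting_def * by simp
qed

section \<open>Separation of adjacent parts by deleting their edge\<close>

lemma connected_induced_path:
  assumes "connected_graph (induced G X)" "X \<subseteq> verts G" "u \<in> X" "v \<in> X" "\<not> e \<subseteq> X"
  shows "(u, v) \<in> (adj (edges G - {e}))\<^sup>*"
proof -
  have "(u, v) \<in> (adj (edges (induced G X)))\<^sup>*"
    using assms(1-4) by (auto simp: connected_graph_def reachable_def adj_def induced_def)
  then show ?thesis by (rule adj_rtrancl_mono[rotated]) (use assms(5) in \<open>auto simp: induced_def\<close>)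
qed

text \<open>Such a path could be prolonged inside \<open>X\<close> to \<open>x\<close> and inside
  \<open>Y\<close> to \<open>y\<close>, and would bypass the bridge \<open>{x, y}\<close>.\<close>

lemma forest_unreachable_without_edge:
  assumes F: "forest F" and X: "connected_graph (induced F X)" "X \<subseteq> verts F"
    and Y: "connected_graph (induced F Y)" "Y \<subseteq> verts F" and XY: "X \<inter> Y = {}"
    and xy: "x \<in> X" "y \<in> Y" "{x, y} \<in> edges F" and uv: "u \<in> X" "v \<in> Y"
  shows "(u, v) \<notin> (adj (edges F - {{x, y}}))\<^sup>*"
proof
  assume "(u, v) \<in> (adj (edges F - {{x, y}}))\<^sup>*"
  moreover have "(x, u) \<in> (adj (edges F - {{x, y}}))\<^sup>*"
    using connected_induced_path[OF X xy(1) uv(1)] xy XY by blast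
  moreover have "(v, y) \<in> (adj (edges F - {{x, y}}))\<^sup>*"
    using connected_induced_path[OF Y uv(2) xy(2)] xy XY by blast
  ultimately have "(x, y) \<in> (adj (edges F - {{x, y}}))\<^sup>*" by (meson rtrancl_trans)
  with F xy(3) show False by (auto simp: forest_iff_acyclic_edges acyclic_edges_def)
qed

text \<open>A second crossing edge would by itself connect the parts after deletion of the
  first.\<close>

lemma forest_unique_edge_between:
  assumes F: "forest F" and X: "connected_graph (induced F X)" "X \<subseteq> verts F"
    and Y: "connected_graph (induced F Y)" "Y \<subseteq> verts F" and XY: "X \<inter> Y = {}"
    and xy: "x \<in> X" "y \<in> Y" "{x, y} \<in> edges F" and uv: "u \<in> X" "v \<in> Y" "{u, v} \<in> edges F"
  shows "u = x \<and> v = y"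
proof (rule ccontr)
  assume "\<not> (u = x \<and> v = y)"
  then have "{u, v} \<noteq> {x, y}" using xy uv XY by (auto simp: doubleton_eq_iff)
  with uv(3) have "(u, v) \<in> (adj (edges F - {{x, y}}))\<^sup>*" by (intro adj_rtranclI) blast
  with forest_unreachable_without_edge[OF F X Y XY xy uv(1,2)] show False by blast
qed

text \<open>Deleting \<open>{x, y}\<close> separates \<open>X\<close> from \<open>Y\<close>, so
  \<open>{u, v}\<close> can be added without a cycle. Edges inside the parts are untouched, and the
  same pairs of parts remain adjacent. The case \<open>{u, v} = {x, y}\<close> is included.\<close>

lemma principal_exchange:
  assumes \<Phi>: "undirected_graph \<Phi>" "finite (verts \<Phi>)" and P: "partition_on (verts \<Phi>) P"
    and F: "principal \<Phi> P F' F" and XY: "X \<in> P" "Y \<in> P" "X \<noteq> Y"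
    and xy: "x \<in> X" "y \<in> Y" "{x, y} \<in> edges F" and uv: "u \<in> X" "v \<in> Y" "{u, v} \<in> edges \<Phi>"
  obtains H where "principal \<Phi> P F' H"
    "total_weight H = total_weight F - wt \<Phi> x y + wt \<Phi> u v"
proof -
  from F have subF: "subgraph F \<Phi>" and VF: "verts F = verts \<Phi>" and forF: "forest F"
    and divF: "tree_divisible F P" and spl: "edges F' = edges (splitting F P)"
    by (auto simp: principal_def spanning_forests_def)
  have disj: "A \<inter> B = {}" if "A \<in> P" "B \<in> P" "A \<noteq> B" for A B
    using P that by (auto simp: partition_on_def disjoint_def)
  have same: "A = B" if "A \<in> P" "B \<in> P" "a \<in> A" "a \<in> B" for A B a
    using disj that by blast
  have sub: "A \<subseteq> verts F" if "A \<in> P" for A using P that VF by (auto simp: partition_on_def)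
  have conn: "connected_graph (induced F A)" if "A \<in> P" for A
    using divF that by (simp add: tree_divisible_def)
  let ?D = "edges F - {{x, y}}"
  have sep: "(u, v) \<notin> (adj ?D)\<^sup>*"
    using forest_unreachable_without_edge[OF forF conn[OF XY(1)] sub[OF XY(1)] conn[OF XY(2)]
      sub[OF XY(2)] disj[OF XY] xy uv(1,2)] .
  \<comment> \<open>Hence the weight of the new edge is counted exactly once in
    \<open>total_weight H\<close>.\<close>
  then have uvD: "{u, v} \<notin> ?D" using adj_rtranclI by metis
  define H where "H = \<lparr>verts = verts \<Phi>, edges = insert {u, v} ?D, wt = wt \<Phi>\<rparr>"
  have EH: "edges H \<subseteq> edges \<Phi>" using subF uv(3) by (auto simp: H_def subgraph_def)
  have undH: "undirected_graph H"
  proof -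
    have "e \<in> edges \<Phi>" if "e \<in> edges H" for e using that EH by blast
    moreover have "verts H = verts \<Phi>" "wt H = wt \<Phi>" by (simp_all add: H_def)
    ultimately show ?thesis using \<Phi>(1) unfolding undirected_graph_def by metis
  qed
  have subH: "subgraph H \<Phi>" using undH EH by (simp add: subgraph_def H_def)
  have "acyclic_edges (edges H)"
    using acyclic_edges_insert[OF acyclic_edges_mono sep] forF
    by (auto simp: forest_iff_acyclic_edges H_def)
  with undH have forH: "forest H" by (simp add: forest_iff_acyclic_edges)
  have divH: "tree_divisible H P"
    unfolding tree_divisible_def
  proof
    fix A assume A: "A \<in> P"
    \<comment> \<open>Both exchanged edges run between distinct parts, so neither lies inside
      \<open>A\<close>.\<close>
    have "\<not> {x, y} \<subseteq> A" "\<not> {u, v} \<subseteq> A" using same[OF A] XY xy uv by blast+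
    then have "edges (induced H A) = edges (induced F A)"
      by (auto simp: induced_def H_def)
    moreover have "verts (induced H A) = verts (induced F A)"
      by (simp add: induced_def H_def VF)
    ultimately show "connected_graph (induced H A)"
      using conn[OF A] by (simp add: connected_graph_def reachable_def)
  qed
  have cross: "(\<exists>a\<in>A. \<exists>b\<in>B. {a, b} \<in> edges H) \<longleftrightarrow> (\<exists>a\<in>A. \<exists>b\<in>B. {a, b} \<in> edges F)"
    if "A \<in> P" "B \<in> P" for A B
  proof -
    \<comment> \<open>An edge between \<open>X\<close> and \<open>Y\<close> that also joins
      \<open>A\<close> to \<open>B\<close> forces these pairs of parts to agree up to order; any
      other edge between \<open>X\<close> and \<open>Y\<close> then joins \<open>A\<close> to
      \<open>B\<close> as well. Both directions of the equivalence use this, with the two edges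
      swapped.\<close>
    have transfer: "\<exists>a\<in>A. \<exists>b\<in>B. {a, b} = {s', t'}"
      if "a \<in> A" "b \<in> B" "{a, b} = {s, t}" "s \<in> X" "t \<in> Y" "s' \<in> X" "t' \<in> Y" for a b s t s' t'
    proof -
      from that(1-5) have "A = X \<and> B = Y \<or> A = Y \<and> B = X"
        using same[OF \<open>A \<in> P\<close>] same[OF \<open>B \<in> P\<close>] XY by (auto simp: doubleton_eq_iff)
      with that(6,7) show ?thesis by (auto simp: insert_commute)
    qed
    show ?thesis
    proof
      assume "\<exists>a\<in>A. \<exists>b\<in>B. {a, b} \<in> edges H"
      then obtain a b where "a \<in> A" "b \<in> B" "{a, b} = {u, v} \<or> {a, b} \<in> edges F"
        by (auto simp: H_def)
      then show "\<exists>a\<in>A. \<exists>b\<in>B. {a, b} \<in> edges F"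
        using transfer[of a b u v x y] uv(1,2) xy by metis
    next
      assume "\<exists>a\<in>A. \<exists>b\<in>B. {a, b} \<in> edges F"
      then obtain a b where "a \<in> A" "b \<in> B" "{a, b} = {x, y} \<or> {a, b} \<in> edges H"
        by (auto simp: H_def)
      moreover have "{u, v} \<in> edges H" by (simp add: H_def)
      ultimately show "\<exists>a\<in>A. \<exists>b\<in>B. {a, b} \<in> edges H"
        using transfer[of a b x y u v] uv(1,2) xy(1,2) by metis
    qed
  qed
  have "edges (splitting H P) = edges (splitting F P)"
  proof -
    have H: "finite (verts H)" "partition_on (verts H) P" using \<Phi>(2) P by (simp_all add: H_def)
    from cross have *: "A \<in> P \<and> B \<in> P \<and> A \<noteq> B \<and> (\<exists>a\<in>A. \<exists>b\<in>B. {a, b} \<in> edges H) \<longleftrightarrow>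
      A \<in> P \<and> B \<in> P \<and> A \<noteq> B \<and> (\<exists>a\<in>A. \<exists>b\<in>B. {a, b} \<in> edges F)" for A B
      by (intro conj_cong refl) simp_all
    have "edges (splitting H P) =
      {{A, B} |A B. A \<in> P \<and> B \<in> P \<and> A \<noteq> B \<and> (\<exists>a\<in>A. \<exists>b\<in>B. {a, b} \<in> edges F)}"
      unfolding edges_splitting[OF forH H divH] * ..
    also have "\<dots> = edges (splitting F P)"
      using edges_splitting[OF forF] \<Phi>(2) P divF VF by simp
    finally show ?thesis .
  qed
  \<comment> \<open>The number of trees required by \<open>principal\<close> is witnessed by
    \<open>card (components H)\<close>.\<close>
  with subH forH divH spl have "principal \<Phi> P F' H"
    by (auto simp: principal_def spanning_forests_def H_def)
  moreover have "total_weight H = total_weight F - wt \<Phi> x y + wt \<Phi> u v"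
  proof -
    have finF: "finite (edges F)"
      using undirected_finite_edges[OF subgraph_undirected[OF subF]] VF \<Phi>(2) by simp
    have xy\<Phi>: "{x, y} \<in> edges \<Phi>" using xy(3) subF by (auto simp: subgraph_def)
    have "total_weight F = edge_weight \<Phi> {x, y} + sum (edge_weight \<Phi>) ?D"
      using subgraph_total_weight[OF \<Phi>(1) subF] sum.remove[OF finF xy(3)] by simp
    moreover have "total_weight H = edge_weight \<Phi> {u, v} + sum (edge_weight \<Phi>) ?D"
      using subgraph_total_weight[OF \<Phi>(1) subH] uvD finF unfolding H_def by simp
    ultimately show ?thesis
      using edge_weight_doubleton[OF \<Phi>(1) xy\<Phi>] edge_weight_doubleton[OF \<Phi>(1) uv(3)] by simp
  qed
  ultimately show thesis using that by blast
qed

section \<open>Equality of the weights along an edge of the splitting\<close>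

theorem theorem2:
  fixes \<Phi> F :: "'a wgraph" and P :: "'a set set" and F' :: "'a set wgraph"
    and X Y :: "'a set" and k :: nat
  assumes "undirected_graph \<Phi>" and "finite (verts \<Phi>)"
    and "partition_on (verts \<Phi>) P" and "tree_divisible \<Phi> P"
    and "F' \<in> spanning_forests k (splitting \<Phi> P)"
    and "minimal_principal \<Phi> P F' F"
    and "{X, Y} \<in> edges F'"
  shows "(\<exists>!(x, y). x \<in> X \<and> y \<in> Y \<and> {x, y} \<in> edges F) \<and>
    (\<forall>x\<in>X. \<forall>y\<in>Y. {x, y} \<in> edges F \<longrightarrow>
       wt F' X Y = wt (splitting \<Phi> P) X Y \<and>
       wt (splitting \<Phi> P) X Y = wt \<Phi> x y \<and>
       wt \<Phi> x y = wt (splitting F P) X Y)"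
proof -
  note \<Phi> = assms(1,2) and P = assms(3)
  from assms(6) have pF: "principal \<Phi> P F' F"
    and minF: "\<And>H. principal \<Phi> P F' H \<Longrightarrow> total_weight F \<le> total_weight H"
    by (auto simp: minimal_principal_def)
  from pF have subF: "subgraph F \<Phi>" and VF: "verts F = verts \<Phi>" and forF: "forest F"
    and divF: "tree_divisible F P" and spl: "edges F' = edges (splitting F P)"
    by (auto simp: principal_def spanning_forests_def)
  have undF: "undirected_graph F" and finF: "finite (verts F)"
    using subF VF \<Phi>(2) by (simp_all add: subgraph_def)
  obtain A B where AB: "{X, Y} = {A, B}" "A \<in> P" "B \<in> P" "A \<noteq> B"
    and exAB: "\<exists>a\<in>A. \<exists>b\<in>B. {a, b} \<in> edges F"
    using assms(7) edges_splitting[OF forF finF] P VF divF spl by auto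
  \<comment> \<open>Edges are unordered, so \<open>X\<close> and \<open>Y\<close> are recovered only
    up to a swap.\<close>
  from AB(1) have cases: "X = A \<and> Y = B \<or> X = B \<and> Y = A" by (simp add: doubleton_eq_iff)
  with AB have XY: "X \<in> P" "Y \<in> P" "X \<noteq> Y" by metis+
  have ex: "\<exists>x\<in>X. \<exists>y\<in>Y. {x, y} \<in> edges F" using cases exAB by (metis insert_commute)
  have disj: "X \<inter> Y = {}" using P XY by (auto simp: partition_on_def disjoint_def)
  have X: "connected_graph (induced F X)" "X \<subseteq> verts F"
    and Y: "connected_graph (induced F Y)" "Y \<subseteq> verts F"
    using divF P XY VF by (auto simp: tree_divisible_def partition_on_def)
  note uniq = forest_unique_edge_between[OF forF X Y disj]
  have "\<exists>!(x, y). x \<in> X \<and> y \<in> Y \<and> {x, y} \<in> edges F"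
  proof -
    from ex obtain x y where "x \<in> X" "y \<in> Y" "{x, y} \<in> edges F" by blast
    then show ?thesis by (intro ex1I[of _ "(x, y)"]) (auto dest: uniq)
  qed
  moreover have "wt F' X Y = wt (splitting \<Phi> P) X Y \<and>
       wt (splitting \<Phi> P) X Y = wt \<Phi> x y \<and> wt \<Phi> x y = wt (splitting F P) X Y"
    if xy: "x \<in> X" "y \<in> Y" "{x, y} \<in> edges F" for x y
  proof (intro conjI)
    have xy\<Phi>: "{x, y} \<in> edges \<Phi>" and wxy: "wt F x y = wt \<Phi> x y"
      using xy(3) subF by (auto simp: subgraph_def)
    have TF: "induced F X \<in> trees_on F X" by (rule induced_forest_in_trees_on[OF forF X])
    then have T\<Phi>: "induced F X \<in> trees_on \<Phi> X"
      using subF by (auto simp: trees_on_def intro: subgraph_trans)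
    show "wt F' X Y = wt (splitting \<Phi> P) X Y"
      using assms(5,7) by (auto simp: spanning_forests_def subgraph_def)
    have "nu_between \<Phi> X Y - nu \<Phi> X = wt \<Phi> x y"
    proof (rule nu_between_minus_nu[OF \<Phi> disj _ xy(1,2) xy\<Phi>])
      fix u v assume uv: "u \<in> X" "v \<in> Y" "{u, v} \<in> edges \<Phi>"
      obtain H where "principal \<Phi> P F' H"
        "total_weight H = total_weight F - wt \<Phi> x y + wt \<Phi> u v"
        using principal_exchange[OF \<Phi> P pF XY xy uv] by blast
      \<comment> \<open>The exchange changes the weight by
        \<open>wt \<Phi> u v - wt \<Phi> x y\<close>, which minimality of \<open>F\<close> keeps
        from being negative.\<close>
      with minF[of H] show "wt \<Phi> x y \<le> wt \<Phi> u v" by simp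
    qed (use T\<Phi> in blast)
    then show "wt (splitting \<Phi> P) X Y = wt \<Phi> x y" by (simp add: splitting_def)
    \<comment> \<open>Within \<open>F\<close> the edge \<open>{x, y}\<close> is the only one between
      the parts, hence trivially the lightest.\<close>
    have "nu_between F X Y - nu F X = wt F x y"
      by (rule nu_between_minus_nu[OF undF finF disj _ xy]) (use TF uniq[OF xy] in auto)
    then show "wt \<Phi> x y = wt (splitting F P) X Y" by (simp add: splitting_def wxy)
  qed
  ultimately show ?thesis by blast
qed

end
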